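(* Let $\lambda\ge0$ and let $u,v$ be solutions of the flow $$\dot u(t)=-\lambda u(t)-v(t)\cdot\nabla F(u(t)\cdot v(t)),\qquad \dot v(t)=-\lambda v(t)-u(t)\cdot\nabla F(u(t)\cdot v(t)),$$ with initial values satisfying $|u(0)_i|\neq|v(0)_i|$ for all $i$. Let $x(t)=u(t)\cdot v(t)$. Then $$\frac{\mathrm d}{\mathrm dt}\nabla\eta_{\gamma(t)}(x(t))=-2\nabla F(x(t)),\qquad\text{where }\gamma(t)=\tfrac12\,|u(0)^2-v(0)^2|\,\exp(-2\lambda t),$$ and $\eta_\gamma$ is the hyperbolic entropy function.
   Context: $F:\mathbb{R}^n\to\mathbb{R}$ is a differentiable convex function, and $u(t),v(t)\in\mathbb{R}^n$. Products $u\cdot v=(u_iv_i)_i$, squares and absolute values of vectors are taken entrywise. The flow above is the continuous-time limit of gradient descent on $G(u,v)=F(u\cdot v)+\frac\lambda2\|u\|_2^2+\frac\lambda2\|v\|_2^2$. For a scalar $c>0$, the hyperbolic entropy is $\eta_c(s)=s\,\mathrm{arcsinh}(s/c)-\sqrt{s^2+c^2}+c$, $s\in\mathbb{R}$, so that $\eta_c'(s)=\mathrm{arcsinh}(s/c)$. For a vector $\gamma\in\mathbb{R}^n$ with positive entries, $\eta_\gamma(x)=\sum_i\eta_{\gamma_i}(x_i)$, so $\nabla\eta_\gamma(x)=(\mathrm{arcsinh}(x_i/\gamma_i))_i$. In the claim, $\nabla\eta_{\gamma(t)}(x(t))$ denotes $\nabla \eta_\gamma(x)$ evaluated at $\gamma=\gamma(t)$,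 $x=x(t)$, and the derivative $\frac{\mathrm d}{\mathrm dt}$ is the total derivative in $t$. *)

theory Defs
  imports "HOL-Analysis.Analysis"
begin

definition gradient :: "('a::real_inner \<Rightarrow> real) \<Rightarrow> 'a \<Rightarrow> 'a" where
  "gradient f x = (THE D. GDERIV f x :> D)"

lemma gradient_eqI:
  assumes "GDERIV f x :> D"
  shows "gradient f x = D"
  unfolding gradient_def
proof (rule the_equality[where a = D])
  fix D' assume "GDERIV f x :> D'"
  with assms have "(\<lambda>h. h \<bullet> D') = (\<lambda>h. h \<bullet> D)"
    unfolding gderiv_def by (rule has_derivative_unique[rotated])
  then show "D' = D"
    by (metis inner_commute vector_eq_ldot)
qed (fact assms)

lemma GDERIV_gradient:
  fixes f :: "'a::euclidean_space \<Rightarrow> real"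
  assumes "f differentiable (at x)"
  shows "GDERIV f x :> gradient f x"
proof -
  obtain f' where f': "(f has_derivative f') (at x)"
    using assms unfolding differentiable_def by blast
  then interpret linear f'
    by (rule has_derivative_linear)
  have "f' h = h \<bullet> adjoint f' 1" for h
    using adjoint_works[OF linear_axioms, of h 1] by simp
  then have "f' = (\<lambda>h. h \<bullet> adjoint f' 1)" by blast
  with f' have "GDERIV f x :> adjoint f' 1"
    unfolding gderiv_def by metis
  then show ?thesis
    by (simp only: gradient_eqI)
qed

definition scalar_hyperbolic_entropy :: "real \<Rightarrow> real \<Rightarrow> real" where
  "scalar_hyperbolic_entropy c s = s * arsinh (s / c) - sqrt (s\<^sup>2 + c\<^sup>2) + c"

text \<open>Meaningful for parameter vectors with positive entries.\<close>

definition hyperbolic_entropy :: "real ^ 'n \<Rightarrow> real ^ 'n \<Rightarrow> real" where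
  "hyperbolic_entropy \<gamma> x = (\<Sum>i\<in>UNIV. scalar_hyperbolic_entropy (\<gamma> $ i) (x $ i))"

text \<open>On \<open>real ^ 'n\<close> the operations \<open>*\<close>, \<open>^\<close> and \<open>\<bar>_\<bar>\<close> are the entrywise ones.\<close>

lemma vec_power_nth: "(x ^ k) $ i = (x $ i) ^ k" for x :: "real ^ 'n"
  by (induction k) simp_all

lemma vec_abs_nth: "\<bar>x\<bar> $ i = \<bar>x $ i\<bar>" for x :: "real ^ 'n"
  by (simp add: abs_vec_def)

end

theory Submission
  imports Defs
begin

text \<open>
  The flow decouples into one planar system per coordinate: with \<open>a = u\<^sub>i\<close>, \<open>b = v\<^sub>i\<close> and
  \<open>g = (\<nabla>F(u \<cdot> v))\<^sub>i\<close> regarded as a given function of time, it reads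
  \<open>a' = - \<lambda> a - g b\<close>, \<open>b' = - \<lambda> b - g a\<close>. The combinations \<open>a + b\<close> and \<open>a - b\<close> diagonalise it:
  \<open>(a + b)' = - (\<lambda> + g) (a + b)\<close> and \<open>(a - b)' = - (\<lambda> - g) (a - b)\<close>.

  Their product \<open>a\<^sup>2 - b\<^sup>2\<close> no longer feels \<open>g\<close> and decays exactly like \<open>exp (- 2 \<lambda> t)\<close>
  (\<open>square_difference_decay\<close>). So the parameter \<open>\<gamma>\<^sub>i(t)\<close> is nothing but
  \<open>\<bar>a(t)\<^sup>2 - b(t)\<^sup>2\<bar> / 2\<close>, and it never vanishes. For this value of the parameter the mirror
  coordinate has a closed form (\<open>arsinh_product\<close>),
  \<open>arsinh (a b / \<gamma>\<^sub>i) = ln ((a + b)\<^sup>2) - ln \<bar>a\<^sup>2 - b\<^sup>2\<bar> = ln (\<bar>a + b\<bar> / \<bar>a - b\<bar>)\<close>.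
  Its derivative is \<open>- (\<lambda> + g) + (\<lambda> - g) = - 2 g\<close>: the common decay rate \<open>\<lambda>\<close> drops out of the
  quotient, just as \<open>g\<close> drops out of the product (\<open>mirror_coordinate_derivative\<close>).
  It remains to identify the gradient of the hyperbolic entropy with the vector of these inverse
  hyperbolic sines (\<open>gradient_hyperbolic_entropy\<close>) and to differentiate coordinatewise.
\<close>

lemma has_vector_derivative_vec_iff:
  fixes f :: "real \<Rightarrow> real ^ 'n"
  shows "(f has_vector_derivative D) (at t within T) \<longleftrightarrow>
    (\<forall>i. ((\<lambda>s. f s $ i) has_real_derivative D $ i) (at t within T))"
  unfolding has_real_derivative_iff_has_vector_derivative has_vector_derivative_def
    has_derivative_componentwise_within[where f = f]
  by (simp add: Basis_vec_def inner_axis)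

lemma scalar_hyperbolic_entropy_derivative:
  assumes "c > 0"
  shows "(scalar_hyperbolic_entropy c has_real_derivative arsinh (s / c)) (at s)"
proof -
  have pos: "s\<^sup>2 + c\<^sup>2 > 0"
    using assms by (simp add: add_nonneg_pos)
  have root: "sqrt ((s / c)\<^sup>2 + 1) = sqrt (s\<^sup>2 + c\<^sup>2) / c"
  proof -
    have "(s / c)\<^sup>2 + 1 = (s\<^sup>2 + c\<^sup>2) / c\<^sup>2"
      using assms by (simp add: field_simps)
    then show ?thesis
      using assms by (simp add: real_sqrt_divide)
  qed
  have "((\<lambda>s. arsinh (s / c)) has_real_derivative
      1 / sqrt ((s / c)\<^sup>2 + 1) * (1 / c)) (at s)"
    by (rule DERIV_chain2[OF arsinh_real_has_field_derivative DERIV_cdivide[OF DERIV_ident]])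
  note [derivative_intros] = this
  have "((\<lambda>s. s * arsinh (s / c) - sqrt (s\<^sup>2 + c\<^sup>2) + c) has_real_derivative
      (arsinh (s / c) + s * (1 / sqrt ((s / c)\<^sup>2 + 1) * (1 / c))
        - inverse (sqrt (s\<^sup>2 + c\<^sup>2)) / 2 * (2 * s))) (at s)"
    using pos by (auto intro!: derivative_eq_intros)
  also have "arsinh (s / c) + s * (1 / sqrt ((s / c)\<^sup>2 + 1) * (1 / c))
        - inverse (sqrt (s\<^sup>2 + c\<^sup>2)) / 2 * (2 * s) = arsinh (s / c)"
    using assms pos unfolding root by (simp add: field_simps)
  finally show ?thesis
    by (simp add: scalar_hyperbolic_entropy_def[abs_def])
qed

lemma gradient_hyperbolic_entropy:
  fixes \<gamma> x :: "real ^ 'n"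
  assumes "\<And>i. \<gamma> $ i > 0"
  shows "gradient (hyperbolic_entropy \<gamma>) x = (\<chi> i. arsinh (x $ i / \<gamma> $ i))"
proof (rule gradient_eqI)
  have "((\<lambda>y. scalar_hyperbolic_entropy (\<gamma> $ i) (y $ i)) has_derivative
      (\<lambda>h. h $ i * arsinh (x $ i / \<gamma> $ i))) (at x)" for i
    using has_derivative_compose[OF
        bounded_linear_imp_has_derivative[OF bounded_linear_vec_nth[of i]]
        scalar_hyperbolic_entropy_derivative[OF assms, unfolded has_field_derivative_def]]
    by (simp add: mult.commute)
  then show "GDERIV (hyperbolic_entropy \<gamma>) x :> (\<chi> i. arsinh (x $ i / \<gamma> $ i))"
    unfolding gderiv_def hyperbolic_entropy_def[abs_def] inner_vec_def
    by (auto intro!: has_derivative_sum)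
qed

text \<open>
  The number \<open>\<bar>a\<^sup>2 - b\<^sup>2\<bar> / 2\<close> is the parameter that turns the square root inside \<open>arsinh\<close> into a
  rational expression, because \<open>(2 a b)\<^sup>2 + (a\<^sup>2 - b\<^sup>2)\<^sup>2 = (a\<^sup>2 + b\<^sup>2)\<^sup>2\<close>.
\<close>

lemma arsinh_product:
  fixes a b :: real
  assumes "a\<^sup>2 \<noteq> b\<^sup>2"
  shows "arsinh (a * b / (\<bar>a\<^sup>2 - b\<^sup>2\<bar> / 2)) = ln ((a + b)\<^sup>2) - ln \<bar>a\<^sup>2 - b\<^sup>2\<bar>"
proof -
  define p where "p = \<bar>a\<^sup>2 - b\<^sup>2\<bar>"
  have p: "p > 0" and p2: "p\<^sup>2 = (a\<^sup>2 - b\<^sup>2)\<^sup>2"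
    using assms by (auto simp: p_def)
  have "a + b \<noteq> 0"
    using assms by (auto simp: add_eq_0_iff2)
  have "(a * b / (p / 2))\<^sup>2 + 1 = (4 * a\<^sup>2 * b\<^sup>2 + p\<^sup>2) / p\<^sup>2"
    using p by (simp add: field_simps)
  also have "\<dots> = ((a\<^sup>2 + b\<^sup>2) / p)\<^sup>2"
    unfolding p2 power_divide by (simp add: power2_eq_square algebra_simps)
  finally have "sqrt ((a * b / (p / 2))\<^sup>2 + 1) = (a\<^sup>2 + b\<^sup>2) / p"
    using p by simp
  then have "arsinh (a * b / (p / 2)) = ln (a * b / (p / 2) + (a\<^sup>2 + b\<^sup>2) / p)"
    by (simp only: arsinh_real_def)
  also have "a * b / (p / 2) + (a\<^sup>2 + b\<^sup>2) / p = (a + b)\<^sup>2 / p"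
    using p by (simp add: field_simps power2_eq_square)
  also have "ln \<dots> = ln ((a + b)\<^sup>2) - ln p"
    using p \<open>a + b \<noteq> 0\<close> by (simp add: ln_div)
  finally show ?thesis
    by (simp add: p_def)
qed

text \<open>
  In the derivative of \<open>a\<^sup>2 - b\<^sup>2\<close> the two contributions \<open>- 2 a b g\<close> cancel, whatever \<open>g\<close> is.
  What is left is a homogeneous linear equation, solved with its integrating factor.
\<close>

lemma square_difference_decay:
  fixes a b g :: "real \<Rightarrow> real"
  assumes "is_interval T" "0 \<in> T" "t \<in> T"
    and a: "\<And>t. t \<in> T \<Longrightarrow> (a has_real_derivative - (lam * a t) - b t * g t) (at t within T)"
    and b: "\<And>t. t \<in> T \<Longrightarrow> (b has_real_derivative - (lam * b t) - a t * g t) (at t within T)"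
  shows "(a t)\<^sup>2 - (b t)\<^sup>2 = exp (- 2 * lam * t) * ((a 0)\<^sup>2 - (b 0)\<^sup>2)"
proof -
  let ?q = "\<lambda>t. exp (2 * lam * t) * ((a t)\<^sup>2 - (b t)\<^sup>2)"
  have "(?q has_real_derivative 0) (at s within T)" if "s \<in> T" for s
    by (rule derivative_eq_intros a b refl that)+
      (simp add: power2_eq_square algebra_simps)
  then obtain C where "\<forall>s\<in>T. ?q s = C"
    using has_field_derivative_zero_constant[of T ?q] assms(1)
    by (auto simp: is_interval_convex)
  then have "?q t = ?q 0"
    using assms(2,3) by metis
  then show ?thesis
    by (simp add: exp_minus field_simps)
qed

text \<open>
  By \<open>square_difference_decay\<close> the term \<open>ln \<bar>a\<^sup>2 - b\<^sup>2\<bar>\<close> in \<open>arsinh_product\<close> is affine in time with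
  slope \<open>- 2 \<lambda>\<close>. It compensates exactly the decay part of
  \<open>(ln ((a + b)\<^sup>2))' = - 2 (\<lambda> + g)\<close>.
\<close>

lemma mirror_coordinate_derivative:
  fixes a b g :: "real \<Rightarrow> real"
  assumes T: "is_interval T" "0 \<in> T" "t \<in> T"
    and a: "\<And>t. t \<in> T \<Longrightarrow> (a has_real_derivative - (lam * a t) - b t * g t) (at t within T)"
    and b: "\<And>t. t \<in> T \<Longrightarrow> (b has_real_derivative - (lam * b t) - a t * g t) (at t within T)"
    and init: "\<bar>a 0\<bar> \<noteq> \<bar>b 0\<bar>"
  shows "((\<lambda>s. arsinh (a s * b s / (1 / 2 * exp (- 2 * lam * s) * \<bar>(a 0)\<^sup>2 - (b 0)\<^sup>2\<bar>)))
    has_real_derivative - 2 * g t) (at t within T)"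
proof -
  define p where "p = \<bar>(a 0)\<^sup>2 - (b 0)\<^sup>2\<bar>"
  have p: "p > 0"
    using init by (simp add: p_def power2_eq_iff abs_eq_iff)
  have decay: "\<bar>(a s)\<^sup>2 - (b s)\<^sup>2\<bar> = exp (- 2 * lam * s) * p" if "s \<in> T" for s
    using square_difference_decay[OF T(1,2) that a b] by (simp add: p_def abs_mult)
  have ne: "(a s)\<^sup>2 \<noteq> (b s)\<^sup>2" if "s \<in> T" for s
    using decay[OF that] p by auto
  have closed_form: "arsinh (a s * b s / (1 / 2 * exp (- 2 * lam * s) * p))
      = ln ((a s + b s)\<^sup>2) + 2 * lam * s - ln p" if "s \<in> T" for s
  proof -
    have "1 / 2 * exp (- 2 * lam * s) * p = \<bar>(a s)\<^sup>2 - (b s)\<^sup>2\<bar> / 2"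
      using decay[OF that] by simp
    then show ?thesis
      using arsinh_product[OF ne[OF that]] decay[OF that] p by (simp add: ln_mult)
  qed
  have sum_nz: "a t + b t \<noteq> 0"
    using ne[OF T(3)] by (auto simp: add_eq_0_iff2)
  have "((\<lambda>s. ln ((a s + b s)\<^sup>2) + 2 * lam * s - ln p) has_real_derivative
      1 / (a t + b t)\<^sup>2 *
        (2 * (a t + b t) * (- (lam * a t) - b t * g t + (- (lam * b t) - a t * g t)))
      + 2 * lam) (at t within T)"
    using sum_nz by (auto intro!: derivative_eq_intros a b T(3))
  also have "- (lam * a t) - b t * g t + (- (lam * b t) - a t * g t) = - (lam + g t) * (a t + b t)"
    by (simp add: algebra_simps)
  also have "1 / (a t + b t)\<^sup>2 * (2 * (a t + b t) * (- (lam + g t) * (a t + b t))) + 2 * lam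
      = - 2 * g t"
    using sum_nz by (simp add: power2_eq_square) (simp add: field_simps)
  finally show ?thesis
    unfolding has_real_derivative_iff_has_vector_derivative p_def[symmetric]
    by (rule has_vector_derivative_transform[OF T(3), rotated]) (rule closed_form)
qed

theorem proposition6:
  fixes F :: "real ^ 'n \<Rightarrow> real"
    and u v :: "real \<Rightarrow> real ^ 'n"
    and lam :: real
    and T :: "real set"
  assumes F_differentiable: "\<And>y. F differentiable (at y)"
    and F_convex: "convex_on UNIV F"
    and lam_nonneg: "lam \<ge> 0"
    and T_interval: "is_interval T" "0 \<in> T"
    and flow_u: "\<And>t. t \<in> T \<Longrightarrow>
      (u has_vector_derivative - (lam *\<^sub>R u t) - v t * gradient F (u t * v t)) (at t within T)"
    and flow_v: "\<And>t. t \<in> T \<Longrightarrow>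
      (v has_vector_derivative - (lam *\<^sub>R v t) - u t * gradient F (u t * v t)) (at t within T)"
    and initial: "\<And>i. \<bar>u 0 $ i\<bar> \<noteq> \<bar>v 0 $ i\<bar>"
  shows "let x = (\<lambda>t. u t * v t);
             \<gamma> = (\<lambda>t. ((1 / 2) * exp (- 2 * lam * t)) *\<^sub>R \<bar>(u 0)\<^sup>2 - (v 0)\<^sup>2\<bar>)
         in \<forall>t\<in>T. ((\<lambda>s. gradient (hyperbolic_entropy (\<gamma> s)) (x s))
              has_vector_derivative - 2 *\<^sub>R gradient F (x t)) (at t within T)"
proof -
  let ?\<gamma> = "\<lambda>t. ((1 / 2) * exp (- 2 * lam * t)) *\<^sub>R \<bar>(u 0)\<^sup>2 - (v 0)\<^sup>2\<bar>"
  have \<gamma>_nth: "?\<gamma> s $ i = 1 / 2 * exp (- 2 * lam * s) * \<bar>(u 0 $ i)\<^sup>2 - (v 0 $ i)\<^sup>2\<bar>" for s i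
    by (simp add: vec_abs_nth vec_power_nth)
  have \<gamma>_pos: "?\<gamma> s $ i > 0" for s i
    using initial[of i] unfolding \<gamma>_nth by (simp add: power2_eq_iff abs_eq_iff)
  have "((\<lambda>s. gradient (hyperbolic_entropy (?\<gamma> s)) (u s * v s))
      has_vector_derivative - 2 *\<^sub>R gradient F (u t * v t)) (at t within T)" if "t \<in> T" for t
    unfolding has_vector_derivative_vec_iff gradient_hyperbolic_entropy[OF \<gamma>_pos]
  proof
    fix i
    have u_i: "((\<lambda>t. u t $ i) has_real_derivative
        - (lam * u t $ i) - v t $ i * gradient F (u t * v t) $ i) (at t within T)"
      and v_i: "((\<lambda>t. v t $ i) has_real_derivative
        - (lam * v t $ i) - u t $ i * gradient F (u t * v t) $ i) (at t within T)"
      if "t \<in> T" for t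
      using flow_u[OF that] flow_v[OF that] by (simp_all add: has_vector_derivative_vec_iff)
    have "((\<lambda>s. arsinh (u s $ i * v s $ i /
          (1 / 2 * exp (- 2 * lam * s) * \<bar>(u 0 $ i)\<^sup>2 - (v 0 $ i)\<^sup>2\<bar>))) has_real_derivative
        - 2 * gradient F (u t * v t) $ i) (at t within T)"
      by (rule mirror_coordinate_derivative[OF T_interval that u_i v_i initial])
    then show "((\<lambda>s. (\<chi> i. arsinh ((u s * v s) $ i / ?\<gamma> s $ i)) $ i) has_real_derivative
        (- 2 *\<^sub>R gradient F (u t * v t)) $ i) (at t within T)"
      by (simp add: vec_abs_nth vec_power_nth)
  qed
  then show ?thesis
    by (simp only: Let_def) blast
qed

end
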